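(* Let $d,k\in\mathbb{N}$, let $\alpha>0$ be a fixed number, and let $\nu$ be a square-integrable probability measure on $\mathbb{R}^d$, i.e. $\int_{\mathbb{R}^d}\|x\|_2^2\,d\nu(x)<\infty$. Then the minimization problem $$\min_{A\in\{\mathbb{R}^d\}^k}F_{\nu,\alpha}(A)\quad\text{subject to}\quad A\subset\mathrm{co}(\mathrm{supp}(\nu))$$ admits at least one minimizer, and its optimal value $F_{\nu,\alpha}^\star$ satisfies $$F_{\nu,\alpha}^\star\le\left(\int_{\mathbb{R}^d}\|x-\bar x\|_2^2\,d\nu(x)\right)^{1/2},$$ where $\bar x=\int_{\mathbb{R}^d}x\,d\nu(x)$ is the mean of $\nu$.
   Context: $[k]=\{1,\dots,k\}$. $\{\mathbb{R}^d\}^k$ denotes the set of unordered collections $A=\{a_\ell\}_{\ell\in[k]}$ of $k$ points of $\mathbb{R}^d$ (repetitions allowed), i.e. $(\mathbb{R}^d)^k$ modulo permutation of components. $\mathrm{co}(\cdot)$ denotes convex hull and $d(x,S)=\inf_{y\in S}\|x-y\|_2$. The variance-regularized objective is $$F_{\nu,\alpha}(A)=\left(\int_{\mathbb{R}^d}d^2(x,\mathrm{co}(A))\,d\nu(x)+\frac{\alpha}{k}\sum_{\ell\in[k]}\|a_\ell-\bar a\|_2^2\right)^{1/2},\qquad \bar a=\frac1k\sum_{\ell\in[k]}a_\ell.$$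
   Formalization: The minimizer is found in the closure of co(supp(ν)), since for unbounded support co(supp(ν)) may be non-closed and the minimum not attained there; its value is shown to equal the infimum F* over co(supp(ν)) itself. *)

theory Defs
  imports "HOL-Analysis.Analysis" "HOL-Probability.Probability" "HOL-Library.Multiset"
begin

definition measure_support :: "'a::topological_space measure \<Rightarrow> 'a set" where
  "measure_support M = {x. \<forall>U. open U \<longrightarrow> x \<in> U \<longrightarrow> emeasure M U > 0}"

text \<open>An unordered collection of \<open>k\<close> points, repetitions allowed, is a multiset of size \<open>k\<close>;
  so \<open>k\<close> is recovered below as \<open>size A\<close>.\<close>

definition mset_mean :: "'a::real_vector multiset \<Rightarrow> 'a" where
  "mset_mean A = (1 / real (size A)) *\<^sub>R (\<Sum>a\<in>#A. a)"

definition reg_objective :: "'a::euclidean_space measure \<Rightarrow> real \<Rightarrow> 'a multiset \<Rightarrow> real" where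
  "reg_objective \<nu> \<alpha> A =
     sqrt ((\<integral>x. (infdist x (convex hull (set_mset A)))\<^sup>2 \<partial>\<nu>)
           + \<alpha> / real (size A) * (\<Sum>a\<in>#A. (norm (a - mset_mean A))\<^sup>2))"

definition feasible :: "nat \<Rightarrow> 'a set \<Rightarrow> 'a multiset set" where
  "feasible k S = {A. size A = k \<and> set_mset A \<subseteq> S}"

text \<open>Over a nonempty feasible set the infimum below is genuine, since the objective is
  nonnegative for \<open>\<alpha> \<ge> 0\<close>.

  The convex hull of the support of \<open>\<nu>\<close> need not be closed when the support is unbounded, and
  then the infimum over collections in \<open>convex hull (measure_support \<nu>)\<close> need not be attained
  there. Minimizers are therefore sought in the closed convex hull
  \<open>closure (convex hull (measure_support \<nu>))\<close>; the two sets coincide whenever the convex hull is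
  closed, in particular for compact support.\<close>

definition optimal_value :: "'a::euclidean_space measure \<Rightarrow> real \<Rightarrow> nat \<Rightarrow> 'a set \<Rightarrow> real" where
  "optimal_value \<nu> \<alpha> k S = (INF A\<in>feasible k S. reg_objective \<nu> \<alpha> A)"

end

theory Submission
  imports Defs
begin

text \<open>The direct method. Moving every point of a \<open>k\<close>-tuple by a total of at most \<open>\<delta>\<close> changes the
  distance to its convex hull by at most \<open>\<delta>\<close> everywhere, so the objective is continuous in the
  tuple. The variance term keeps a tuple of bounded objective value within a fixed distance of its
  mean \<open>m\<close>, and then \<open>norm m \<le> norm x + infdist x (convex hull A) + r\<close>, integrated over \<open>x\<close>, bounds
  \<open>m\<close> itself. So minimizing over the closed convex hull \<open>C\<close> of the support reduces to a compact set.
  The bound on the value comes from the constant tuple at the mean of \<open>\<nu>\<close>, which lies in \<open>C\<close>, and by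
  continuity the infimum over the convex hull equals the one over its closure.\<close>

section \<open>Unordered collections as images of tuples\<close>

text \<open>Indexing by functions on \<open>nat\<close> gives collections coordinates that can
  converge, and a product topology in which to find compact sets. Values at indices from
  \<open>k\<close> on have no effect.\<close>

definition tuple_mset :: "nat \<Rightarrow> (nat \<Rightarrow> 'a) \<Rightarrow> 'a multiset" where
  "tuple_mset k a = image_mset a (mset_set {..<k})"

lemma size_tuple_mset [simp]: "size (tuple_mset k a) = k"
  by (simp add: tuple_mset_def)

lemma set_mset_tuple_mset [simp]: "set_mset (tuple_mset k a) = a ` {..<k}"
  by (simp add: tuple_mset_def)

lemma sum_tuple_mset [simp]: "(\<Sum>x\<in>#tuple_mset k a. f x) = (\<Sum>i<k. f (a i))"
  by (simp add: tuple_mset_def sum_unfold_sum_mset image_mset.compositionality comp_def)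

lemma sum_mset_tuple_mset [simp]: "\<Sum>\<^sub># (tuple_mset k a) = (\<Sum>i<k. a i)"
  using sum_tuple_mset[of "\<lambda>x. x" k a] by simp

lemma mset_eq_tuple_mset: "\<exists>a. A = tuple_mset (size A) a"
proof -
  obtain xs where xs: "mset xs = A"
    using ex_mset by blast
  have "A = mset (map (nth xs) [0..<length xs])"
    by (simp add: map_nth xs)
  also have "\<dots> = tuple_mset (size A) (nth xs)"
    by (simp add: tuple_mset_def xs[symmetric] atLeast0LessThan)
  finally show ?thesis
    by blast
qed

lemma feasible_eq: "feasible k S = {tuple_mset k a | a. \<forall>i<k. a i \<in> S}"
proof (intro set_eqI iffI)
  fix A assume A: "A \<in> feasible k S"
  then obtain a where "A = tuple_mset k a"
    using mset_eq_tuple_mset[of A] by (auto simp: feasible_def)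
  with A show "A \<in> {tuple_mset k a | a. \<forall>i<k. a i \<in> S}"
    by (auto simp: feasible_def)
qed (auto simp: feasible_def)

section \<open>Stability of the distance to a convex hull\<close>

text \<open>The Minkowski sum of the second hull and \<open>cball 0 \<delta>\<close> is convex and
  contains each \<open>a i = b i + (a i - b i)\<close>, hence the whole first hull.\<close>

lemma convex_hull_tuple_perturb:
  fixes a b :: "nat \<Rightarrow> 'a::real_normed_vector"
  assumes "\<And>i. i < k \<Longrightarrow> dist (a i) (b i) \<le> \<delta>" and "y \<in> convex hull (a ` {..<k})"
  shows "\<exists>p \<in> convex hull (b ` {..<k}). dist y p \<le> \<delta>"
proof -
  have "convex hull (a ` {..<k}) \<subseteq> convex hull (b ` {..<k}) + cball 0 \<delta>"
  proof (rule hull_minimal)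
    show "a ` {..<k} \<subseteq> convex hull (b ` {..<k}) + cball 0 \<delta>"
    proof clarsimp
      fix i assume "i < k"
      then have "b i \<in> convex hull (b ` {..<k})" "a i - b i \<in> cball 0 \<delta>"
        using assms(1)[of i] by (auto intro: hull_inc simp: dist_norm norm_minus_commute)
      then have "b i + (a i - b i) \<in> convex hull (b ` {..<k}) + cball 0 \<delta>"
        by (rule set_plus_intro)
      then show "a i \<in> convex hull (b ` {..<k}) + cball 0 \<delta>"
        by simp
    qed
  qed (intro convex_set_plus convex_convex_hull convex_cball)
  with assms(2) obtain p q where "p \<in> convex hull (b ` {..<k})" "q \<in> cball 0 \<delta>" "y = p + q"
    by (auto elim!: set_plus_elim)
  then show ?thesis
    by (auto simp: dist_norm intro!: bexI[of _ p])
qed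

lemma infdist_convex_hull_tuple_le:
  fixes a b :: "nat \<Rightarrow> 'a::real_normed_vector"
  assumes "k \<ge> 1" and "\<And>i. i < k \<Longrightarrow> dist (a i) (b i) \<le> \<delta>"
  shows "infdist x (convex hull (b ` {..<k})) \<le> infdist x (convex hull (a ` {..<k})) + \<delta>"
proof -
  have ne: "convex hull (a ` {..<k}) \<noteq> {}"
    using \<open>k \<ge> 1\<close> by (auto simp: lessThan_empty_iff)
  have "infdist x (convex hull (b ` {..<k})) - \<delta> \<le> dist x y"
    if y: "y \<in> convex hull (a ` {..<k})" for y
  proof -
    obtain p where p: "p \<in> convex hull (b ` {..<k})" "dist y p \<le> \<delta>"
      using convex_hull_tuple_perturb[OF assms(2) y] by blast
    have "infdist x (convex hull (b ` {..<k})) \<le> dist x p"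
      using p by (intro infdist_le)
    also have "\<dots> \<le> dist x y + \<delta>"
      using dist_triangle[of x p y] p by linarith
    finally show ?thesis
      by simp
  qed
  then have "infdist x (convex hull (b ` {..<k})) - \<delta> \<le> infdist x (convex hull (a ` {..<k}))"
    unfolding infdist_notempty[OF ne] by (intro cINF_greatest[OF ne])
  then show ?thesis
    by simp
qed

section \<open>Integrability under a square-integrable law\<close>

locale square_integrable_prob = prob_space \<nu>
  for \<nu> :: "'a::euclidean_space measure" +
  assumes sets_eq [measurable_cong]: "sets \<nu> = sets borel"
    and square_integrable: "integrable \<nu> (\<lambda>x. (norm x)\<^sup>2)"
begin

text \<open>Linear growth makes \<open>f\<close> squared at most twice the squared norm plus a
  constant. On a probability space constants are integrable, so the square is integrable, and it
  controls \<open>f\<close> itself because the absolute value of \<open>f\<close> is at most one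
  plus its square.\<close>

lemma integrable_norm_bound:
  fixes f :: "'a \<Rightarrow> real"
  assumes "f \<in> borel_measurable \<nu>" and "\<And>x. \<bar>f x\<bar> \<le> norm x + c"
  shows "integrable \<nu> f" "integrable \<nu> (\<lambda>x. (f x)\<^sup>2)"
proof -
  have le: "0 \<le> norm x + c" for x :: 'a
    using assms(2)[of x] by linarith
  have sq: "(norm x + c)\<^sup>2 \<le> 2 * (norm x)\<^sup>2 + 2 * c\<^sup>2" for x :: 'a
    using sum_squares_bound[of "norm x" c] by (simp add: power2_sum)
  have int: "integrable \<nu> (\<lambda>x. 1 + (2 * (norm x)\<^sup>2 + 2 * c\<^sup>2))"
    using square_integrable by auto
  have "(f x)\<^sup>2 \<le> (norm x + c)\<^sup>2" for x :: 'a
    using assms(2)[of x] le[of x] by (metis abs_le_square_iff abs_of_nonneg)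
  then have b: "(f x)\<^sup>2 \<le> 2 * (norm x)\<^sup>2 + 2 * c\<^sup>2" for x
    using sq order_trans by blast
  show "integrable \<nu> (\<lambda>x. (f x)\<^sup>2)"
    by (rule Bochner_Integration.integrable_bound[OF int])
      (use assms(1) b in \<open>auto intro!: AE_I2 simp: add_increasing\<close>)
  have "\<bar>f x\<bar> \<le> 1 + (f x)\<^sup>2" for x
    using zero_le_power2[of "\<bar>f x\<bar> - 1"] abs_ge_zero[of "f x"]
    unfolding power2_diff by simp
  then have "\<bar>f x\<bar> \<le> 1 + (2 * (norm x)\<^sup>2 + 2 * c\<^sup>2)" for x
    using b by (meson add_left_mono order_trans)
  then show "integrable \<nu> f"
    by (intro Bochner_Integration.integrable_bound[OF int assms(1)])
      (auto intro!: AE_I2 simp: add_increasing)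
qed

lemma integrable_ident: "integrable \<nu> (\<lambda>x. x)"
proof -
  have "integrable \<nu> norm"
    by (rule integrable_norm_bound(1)[where c = 0]) auto
  then show ?thesis
    by (simp add: integrable_norm_iff)
qed

lemma integrable_infdist:
  assumes "A \<noteq> {}"
  shows "integrable \<nu> (\<lambda>x. infdist x A)" "integrable \<nu> (\<lambda>x. (infdist x A)\<^sup>2)"
proof -
  obtain a where "a \<in> A"
    using assms by blast
  then have "\<bar>infdist x A\<bar> \<le> norm x + norm a" for x
    using infdist_le[of a A x] infdist_nonneg[of x A] norm_triangle_ineq4[of x a]
    by (simp add: dist_norm)
  moreover have "(\<lambda>x. infdist x A) \<in> borel_measurable \<nu>"
    using borel_measurable_continuous_onI[of "\<lambda>x. infdist x A"]
    by (simp add: continuous_on_infdist continuous_on_id measurable_cong_sets[OF sets_eq refl])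
  ultimately show "integrable \<nu> (\<lambda>x. infdist x A)" "integrable \<nu> (\<lambda>x. (infdist x A)\<^sup>2)"
    using integrable_norm_bound by blast+
qed

section \<open>Continuity of the objective\<close>

text \<open>An explicit bound in the total displacement \<delta> replaces dominated convergence, so
  the filter \<open>F\<close> is arbitrary. Both sequences and \<open>at a within K\<close> are
  needed later.\<close>

lemma tendsto_integral_infdist_tuple:
  fixes f :: "'b \<Rightarrow> nat \<Rightarrow> 'a"
  assumes "k \<ge> 1" and lim: "\<And>i. i < k \<Longrightarrow> ((\<lambda>n. f n i) \<longlongrightarrow> a i) F"
  shows "((\<lambda>n. \<integral>x. (infdist x (convex hull (f n ` {..<k})))\<^sup>2 \<partial>\<nu>)
          \<longlongrightarrow> (\<integral>x. (infdist x (convex hull (a ` {..<k})))\<^sup>2 \<partial>\<nu>)) F"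
proof -
  define D where "D b x = infdist x (convex hull (b ` {..<k}))" for b :: "nat \<Rightarrow> 'a" and x :: 'a
  define \<delta> where "\<delta> n = (\<Sum>i<k. dist (f n i) (a i))" for n
  have ne: "convex hull (b ` {..<k}) \<noteq> {}" for b :: "nat \<Rightarrow> 'a"
    using \<open>k \<ge> 1\<close> by (auto simp: lessThan_empty_iff)
  have int: "integrable \<nu> (D b)" "integrable \<nu> (\<lambda>x. (D b x)\<^sup>2)" for b
    unfolding D_def by (rule integrable_infdist[OF ne])+
  have \<delta>: "dist (f n i) (a i) \<le> \<delta> n" if "i < k" for n i
    unfolding \<delta>_def using that by (intro member_le_sum) auto
  \<comment> \<open>Factor the difference of squares: the two distances differ by at most \<delta>,
    and their sum is at most \<open>2 * D a x + \<delta> n\<close>.\<close>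
  have pointwise: "\<bar>(D (f n) x)\<^sup>2 - (D a x)\<^sup>2\<bar> \<le> \<delta> n * (2 * D a x + \<delta> n)" for n x
  proof -
    have "D a x \<le> D (f n) x + \<delta> n"
      unfolding D_def using \<open>k \<ge> 1\<close> \<delta> by (intro infdist_convex_hull_tuple_le) auto
    moreover have "D (f n) x \<le> D a x + \<delta> n"
      unfolding D_def using \<open>k \<ge> 1\<close> \<delta>
      by (intro infdist_convex_hull_tuple_le) (auto simp: dist_commute)
    moreover have "D a x \<ge> 0" "D (f n) x \<ge> 0"
      by (auto simp: D_def infdist_nonneg)
    ultimately have "\<bar>D (f n) x + D a x\<bar> * \<bar>D (f n) x - D a x\<bar> \<le> (2 * D a x + \<delta> n) * \<delta> n"
      by (intro mult_mono) auto
    then show ?thesis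
      by (simp add: power2_eq_square square_diff_square_factored abs_mult mult.commute)
  qed
  have bound: "\<bar>(\<integral>x. (D (f n) x)\<^sup>2 \<partial>\<nu>) - (\<integral>x. (D a x)\<^sup>2 \<partial>\<nu>)\<bar>
      \<le> \<delta> n * (2 * (\<integral>x. D a x \<partial>\<nu>) + \<delta> n)" for n
  proof -
    have "\<bar>(\<integral>x. (D (f n) x)\<^sup>2 \<partial>\<nu>) - (\<integral>x. (D a x)\<^sup>2 \<partial>\<nu>)\<bar>
        = \<bar>\<integral>x. (D (f n) x)\<^sup>2 - (D a x)\<^sup>2 \<partial>\<nu>\<bar>"
      using int by simp
    also have "\<dots> \<le> (\<integral>x. \<bar>(D (f n) x)\<^sup>2 - (D a x)\<^sup>2\<bar> \<partial>\<nu>)"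
      by (rule integral_abs_bound)
    also have "\<dots> \<le> (\<integral>x. \<delta> n * (2 * D a x + \<delta> n) \<partial>\<nu>)"
      by (intro integral_mono pointwise) (use int in auto)
    also have "\<dots> = \<delta> n * (2 * (\<integral>x. D a x \<partial>\<nu>) + \<delta> n)"
      using int by (simp add: prob_space)
    finally show ?thesis .
  qed
  have "(\<delta> \<longlongrightarrow> (\<Sum>i<k. dist (a i) (a i))) F"
    unfolding \<delta>_def by (intro tendsto_sum tendsto_dist tendsto_const lim) simp
  then have \<delta>0: "(\<delta> \<longlongrightarrow> 0) F"
    by simp
  have "((\<lambda>n. \<delta> n * (2 * (\<integral>x. D a x \<partial>\<nu>) + \<delta> n)) \<longlongrightarrow> 0) F"
    using tendsto_mult[OF \<delta>0 tendsto_add[OF tendsto_const \<delta>0]] by simp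
  then have "((\<lambda>n. (\<integral>x. (D (f n) x)\<^sup>2 \<partial>\<nu>) - (\<integral>x. (D a x)\<^sup>2 \<partial>\<nu>)) \<longlongrightarrow> 0) F"
    by (rule Lim_null_comparison[OF always_eventually, rotated]) (use bound in auto)
  then show ?thesis
    unfolding D_def by (rule LIM_zero_cancel)
qed

lemma tendsto_reg_objective_tuple:
  fixes f :: "'b \<Rightarrow> nat \<Rightarrow> 'a"
  assumes "k \<ge> 1" and lim: "\<And>i. i < k \<Longrightarrow> ((\<lambda>n. f n i) \<longlongrightarrow> a i) F"
  shows "((\<lambda>n. reg_objective \<nu> \<alpha> (tuple_mset k (f n))) \<longlongrightarrow> reg_objective \<nu> \<alpha> (tuple_mset k a)) F"
  unfolding reg_objective_def mset_mean_def
  by (simp, intro tendsto_intros tendsto_integral_infdist_tuple[OF \<open>k \<ge> 1\<close>])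
    (use lim \<open>k \<ge> 1\<close> in auto)

section \<open>Boundedness of sublevel sets\<close>

lemma reg_objective_sublevel_bounded:
  assumes "k \<ge> 1" and "\<alpha> > 0"
  shows "\<exists>R. \<forall>a. reg_objective \<nu> \<alpha> (tuple_mset k a) \<le> V \<longrightarrow> (\<forall>i<k. norm (a i) \<le> R)"
proof -
  \<comment> \<open>The variance term bounds the sum of squared deviations by
    \<open>V\<^sup>2 * k / \<alpha>\<close>, hence each deviation by \<open>r\<close>. In
    \<open>R\<close>, one \<open>r\<close> comes from locating the hull around the mean and the
    other from passing from the mean to \<open>a i\<close>; \<open>1 + V\<^sup>2\<close> bounds the
    integrated distance.\<close>
  define r where "r = sqrt (V\<^sup>2 * k / \<alpha>)"
  define R where "R = (\<integral>x. norm x \<partial>\<nu>) + 1 + V\<^sup>2 + 2 * r"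
  have "norm (a i) \<le> R" if le: "reg_objective \<nu> \<alpha> (tuple_mset k a) \<le> V" and "i < k" for a i
  proof -
    define m where "m = mset_mean (tuple_mset k a)"
    define H where "H = convex hull (a ` {..<k})"
    define I where "I = (\<integral>x. (infdist x H)\<^sup>2 \<partial>\<nu>)"
    define s where "s = (\<Sum>i<k. (norm (a i - m))\<^sup>2)"
    have H: "H \<noteq> {}"
      using \<open>k \<ge> 1\<close> by (auto simp: H_def lessThan_empty_iff)
    have "I \<ge> 0" "s \<ge> 0"
      by (auto simp: I_def s_def intro: sum_nonneg)
    have "sqrt (I + \<alpha> / k * s) \<le> V"
      using le by (simp add: reg_objective_def I_def s_def m_def H_def)
    then have IV: "I + \<alpha> / k * s \<le> V\<^sup>2"
      by (rule sqrt_le_D)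
    have "I \<le> V\<^sup>2"
      using IV \<open>s \<ge> 0\<close> \<open>\<alpha> > 0\<close> by (smt (verit) divide_nonneg_nonneg mult_nonneg_nonneg of_nat_0_le_iff)
    have "\<alpha> / k * s \<le> V\<^sup>2"
      using IV \<open>I \<ge> 0\<close> by linarith
    then have s: "s \<le> V\<^sup>2 * k / \<alpha>"
      using \<open>\<alpha> > 0\<close> \<open>k \<ge> 1\<close> by (simp add: field_simps)
    have near: "norm (a j - m) \<le> r" if "j < k" for j
    proof -
      have "(norm (a j - m))\<^sup>2 \<le> s"
        unfolding s_def using that by (intro member_le_sum) auto
      with s show ?thesis
        unfolding r_def by (intro real_le_rsqrt) linarith
    qed
    have Hm: "H \<subseteq> cball m r"
      unfolding H_def using near
      by (intro hull_minimal) (auto simp: dist_norm norm_minus_commute)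
    \<comment> \<open>Every point of \<open>H\<close> is within \<open>r\<close> of
      \<open>m\<close>, so a mean far from the origin forces a large distance from \<open>x\<close>
      to \<open>H\<close>.\<close>
    have "norm m - norm x - r \<le> infdist x H" for x
    proof -
      have "norm m - norm x - r \<le> dist x y" if "y \<in> H" for y
      proof -
        have "dist m y \<le> r"
          using Hm that by auto
        then show ?thesis
          using norm_triangle_ineq2[of m x] dist_triangle[of m x y]
          by (simp add: dist_norm norm_minus_commute)
      qed
      then show ?thesis
        using H by (simp add: infdist_notempty cINF_greatest)
    qed
    \<comment> \<open>This trades the distance for its square, whose integral \<open>I\<close> is
      what the objective controls.\<close>
    moreover have "t \<le> 1 + t\<^sup>2" for t :: real
      using zero_le_power2[of "t - 1 / 2"] zero_le_power2[of t]
      unfolding power2_diff power_divide by simp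
    ultimately have "norm m \<le> norm x + (1 + (infdist x H)\<^sup>2) + r" for x
      by (smt (verit))
    then have "(\<integral>x. norm m \<partial>\<nu>) \<le> (\<integral>x. norm x + (1 + (infdist x H)\<^sup>2) + r \<partial>\<nu>)"
      using integrable_infdist[OF H] integrable_norm[OF integrable_ident]
      by (intro integral_mono) auto
    also have "\<dots> = (\<integral>x. norm x \<partial>\<nu>) + (1 + I) + r"
      using integrable_infdist[OF H] integrable_norm[OF integrable_ident]
      by (simp add: prob_space I_def)
    finally have "norm m \<le> (\<integral>x. norm x \<partial>\<nu>) + (1 + V\<^sup>2) + r"
      using \<open>I \<le> V\<^sup>2\<close> by (simp add: prob_space)
    then show ?thesis
      using near[OF \<open>i < k\<close>] norm_triangle_sub[of "a i" m] by (simp add: R_def)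
  qed
  then show ?thesis
    by blast
qed

section \<open>Support and mean of the measure\<close>

text \<open>The complement of the support is the union of all open null sets. By Lindelof countably
  many of them have the same union, which is therefore null.\<close>

lemma AE_measure_support: "AE x in \<nu>. x \<in> measure_support \<nu>"
proof -
  obtain \<G> where \<G>: "\<G> \<subseteq> {U. open U \<and> emeasure \<nu> U = 0}" "countable \<G>"
    "\<Union>\<G> = \<Union>{U. open U \<and> emeasure \<nu> U = 0}"
    using Lindelof[of "{U. open U \<and> emeasure \<nu> U = 0}"] by auto
  have "\<Union>\<G> \<in> null_sets \<nu>"
  proof -
    have "(\<Union>U\<in>\<G>. U) \<in> null_sets \<nu>"
      using \<G> by (intro null_sets_UN') (auto simp: null_sets_def sets_eq)
    then show ?thesis
      by simp
  qed
  then show ?thesis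
    by (rule AE_I'[of "\<Union>\<G>"]) (auto simp: \<G>(3) measure_support_def not_gr_zero)
qed

text \<open>If the mean were outside, a hyperplane would separate it strictly from \<open>C\<close>;
  integrating \<open>u \<bullet> x > b\<close> over almost every \<open>x\<close> contradicts
  this.\<close>

lemma mean_in_closed_convex:
  assumes "closed C" and "convex C" and "AE x in \<nu>. x \<in> C"
  shows "(\<integral>x. x \<partial>\<nu>) \<in> C"
proof (rule ccontr)
  assume "(\<integral>x. x \<partial>\<nu>) \<notin> C"
  then obtain u b where u: "u \<bullet> (\<integral>x. x \<partial>\<nu>) < b" "\<forall>x\<in>C. u \<bullet> x > b"
    using separating_hyperplane_closed_point assms by blast
  have "(\<integral>x. b \<partial>\<nu>) \<le> (\<integral>x. u \<bullet> x \<partial>\<nu>)"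
    using integrable_ident assms(3) u(2) by (intro integral_mono_AE) (auto elim!: eventually_mono)
  then show False
    using u(1) integrable_ident by (simp add: prob_space)
qed

end

section \<open>Existence of a minimizer\<close>

lemma (in square_integrable_prob) reg_objective_minimizer_exists:
  assumes "k \<ge> 1" and "\<alpha> > 0" and "closed C" and "C \<noteq> {}"
  shows "\<exists>A\<in>feasible k C. \<forall>B\<in>feasible k C. reg_objective \<nu> \<alpha> A \<le> reg_objective \<nu> \<alpha> B"
proof -
  obtain c where "c \<in> C"
    using \<open>C \<noteq> {}\<close> by blast
  define G where "G a = reg_objective \<nu> \<alpha> (tuple_mset k a)" for a
  obtain R where R: "norm (a i) \<le> R" if "G a \<le> G (\<lambda>_. c)" "i < k" for a i
    using reg_objective_sublevel_bounded[OF assms(1,2), of "G (\<lambda>_. c)"] unfolding G_def by blast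
  \<comment> \<open>All coordinates are confined, including the irrelevant ones from
    \<open>k\<close> on, so that Tychonoff makes \<open>K\<close> compact in the topology of the
    function space.\<close>
  define K where "K = PiE UNIV (\<lambda>_::nat. C \<inter> cball 0 R)"
  \<comment> \<open>The constant tuple lies in its own sublevel set; index 0, available as
    \<open>k \<ge> 1\<close>, then bounds the norm of \<open>c\<close>.\<close>
  have c: "(\<lambda>_. c) \<in> K"
    using R[of "\<lambda>_. c" 0] \<open>k \<ge> 1\<close> \<open>c \<in> C\<close> by (auto simp: K_def)
  have "compactin (product_topology (\<lambda>_. euclidean) UNIV) K"
    unfolding K_def using \<open>closed C\<close> by (subst compactin_PiE) (auto simp: closed_Int_compact)
  then have "compact K"
    by (simp add: euclidean_product_topology)
  moreover have "continuous_on K G"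
    unfolding continuous_on_def G_def
  proof (intro ballI tendsto_reg_objective_tuple[OF \<open>k \<ge> 1\<close>])
    fix a :: "nat \<Rightarrow> 'a" and i
    have "continuous_on UNIV (\<lambda>a::nat \<Rightarrow> 'a. a i)"
      by simp
    then have "((\<lambda>a. a i) \<longlongrightarrow> a i) (at a)"
      by (simp add: continuous_on_def)
    then show "((\<lambda>a. a i) \<longlongrightarrow> a i) (at a within K)"
      by (rule tendsto_within_subset) simp
  qed
  ultimately obtain a where a: "a \<in> K" "\<And>b. b \<in> K \<Longrightarrow> G a \<le> G b"
    using continuous_attains_inf[of K G] c by blast
  \<comment> \<open>Tuples outside the sublevel set of the constant tuple already lose to it. Those
    inside lie in \<open>K\<close> once their irrelevant coordinates are reset to \<open>c\<close>,
    which leaves the multiset unchanged.\<close>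
  have "G a \<le> G b" if b: "\<And>i. i < k \<Longrightarrow> b i \<in> C" for b
  proof (cases "G b \<le> G (\<lambda>_. c)")
    case True
    define b' where "b' i = (if i < k then b i else c)" for i
    have "b' \<in> K"
      using R[OF True] b c by (auto simp: K_def b'_def)
    moreover have "tuple_mset k b' = tuple_mset k b"
      unfolding tuple_mset_def by (intro image_mset_cong) (auto simp: b'_def)
    ultimately show ?thesis
      using a(2)[of b'] by (simp add: G_def)
  next
    case False
    then show ?thesis
      using a(2)[OF c] by linarith
  qed
  moreover have "\<forall>i<k. a i \<in> C"
    using a(1) by (auto simp: K_def)
  ultimately show ?thesis
    unfolding feasible_eq G_def by blast
qed

section \<open>The optimal value\<close>

lemma reg_objective_nonneg: "\<alpha> \<ge> 0 \<Longrightarrow> reg_objective \<nu> \<alpha> A \<ge> 0"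
proof -
  assume "\<alpha> \<ge> 0"
  obtain k a where "A = tuple_mset k a"
    using mset_eq_tuple_mset by blast
  with \<open>\<alpha> \<ge> 0\<close> show ?thesis
    by (auto simp: reg_objective_def intro!: add_nonneg_nonneg divide_nonneg_nonneg mult_nonneg_nonneg sum_nonneg)
qed

text \<open>Approximating each point of \<open>A\<close> by a sequence in \<open>S\<close> gives
  feasible collections whose objectives tend to that of \<open>A\<close>, so the infimum over
  \<open>S\<close> is no larger. It is no smaller because every collection in \<open>S\<close> is
  also one in its closure.\<close>

lemma (in square_integrable_prob) optimal_value_eq_min_closure:
  assumes "k \<ge> 1" and "\<alpha> \<ge> 0" and A: "A \<in> feasible k (closure S)"
    and min: "\<And>B. B \<in> feasible k (closure S) \<Longrightarrow> reg_objective \<nu> \<alpha> A \<le> reg_objective \<nu> \<alpha> B"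
  shows "reg_objective \<nu> \<alpha> A = optimal_value \<nu> \<alpha> k S"
proof -
  obtain a where a: "A = tuple_mset k a" "\<forall>i<k. a i \<in> closure S"
    using A by (auto simp: feasible_eq)
  have "\<exists>f. (\<forall>n. f n \<in> S) \<and> f \<longlonglongrightarrow> a i" if "i < k" for i
    using a(2) that by (simp add: closure_sequential)
  then obtain f where f: "\<And>i n. i < k \<Longrightarrow> f i n \<in> S" "\<And>i. i < k \<Longrightarrow> f i \<longlonglongrightarrow> a i"
    by metis
  define B where "B n = tuple_mset k (\<lambda>i. f i n)" for n
  have B: "B n \<in> feasible k S" for n
    using f(1) by (auto simp: B_def feasible_eq)
  have "(\<lambda>n. reg_objective \<nu> \<alpha> (B n)) \<longlonglongrightarrow> reg_objective \<nu> \<alpha> A"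
    unfolding B_def a(1) using f(2) by (intro tendsto_reg_objective_tuple[OF \<open>k \<ge> 1\<close>]) auto
  moreover have "optimal_value \<nu> \<alpha> k S \<le> reg_objective \<nu> \<alpha> (B n)" for n
    unfolding optimal_value_def using reg_objective_nonneg[OF \<open>\<alpha> \<ge> 0\<close>]
    by (intro cINF_lower[OF _ B] bdd_belowI2)
  ultimately have "optimal_value \<nu> \<alpha> k S \<le> reg_objective \<nu> \<alpha> A"
    by (intro LIMSEQ_le_const) auto
  moreover have "reg_objective \<nu> \<alpha> A \<le> optimal_value \<nu> \<alpha> k S"
    unfolding optimal_value_def
  proof (rule cINF_greatest)
    show "feasible k S \<noteq> {}"
      using B by blast
    show "reg_objective \<nu> \<alpha> A \<le> reg_objective \<nu> \<alpha> B'" if "B' \<in> feasible k S" for B'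
      using that closure_subset[of S] by (intro min) (auto simp: feasible_def)
  qed
  ultimately show ?thesis
    by simp
qed

text \<open>The hull is a single point and the variance vanishes. With \<open>c\<close> the mean of
  \<nu>, this is the claimed upper bound.\<close>

lemma reg_objective_const_tuple:
  assumes "k \<ge> 1"
  shows "reg_objective \<nu> \<alpha> (tuple_mset k (\<lambda>_. c)) = sqrt (\<integral>x. (norm (x - c))\<^sup>2 \<partial>\<nu>)"
proof -
  have "mset_mean (tuple_mset k (\<lambda>_. c)) = c"
    using assms by (simp add: mset_mean_def sum_constant_scaleR)
  moreover have "(\<lambda>_. c) ` {..<k} = {c}"
    using assms by (auto simp: image_constant_conv lessThan_empty_iff)
  ultimately show ?thesis
    by (simp add: reg_objective_def dist_norm)
qed

theorem theorem1p11:
  fixes \<nu> :: "(real ^ 'd) measure" and \<alpha> :: real and k :: nat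
  assumes "k \<ge> 1" and "\<alpha> > 0"
    and "prob_space \<nu>" and "sets \<nu> = sets borel"
    and "integrable \<nu> (\<lambda>x. (norm x)\<^sup>2)"
  shows "(\<exists>A\<in>feasible k (closure (convex hull (measure_support \<nu>))).
            (\<forall>B\<in>feasible k (closure (convex hull (measure_support \<nu>))).
               reg_objective \<nu> \<alpha> A \<le> reg_objective \<nu> \<alpha> B)
            \<and> reg_objective \<nu> \<alpha> A = optimal_value \<nu> \<alpha> k (convex hull (measure_support \<nu>)))
         \<and> optimal_value \<nu> \<alpha> k (convex hull (measure_support \<nu>))
              \<le> sqrt (\<integral>x. (norm (x - (\<integral>y. y \<partial>\<nu>)))\<^sup>2 \<partial>\<nu>)"
proof -
  interpret square_integrable_prob \<nu>
    by (intro square_integrable_prob.intro square_integrable_prob_axioms.intro assms(3-5))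
  define S where "S = convex hull (measure_support \<nu>)"
  \<comment> \<open>Membership of the mean serves twice: it makes the constraint set nonempty, and
    it makes the constant tuple at the mean an admissible competitor.\<close>
  have mean: "(\<integral>y. y \<partial>\<nu>) \<in> closure S"
  proof (rule mean_in_closed_convex)
    show "AE x in \<nu>. x \<in> closure S"
      using AE_measure_support
      by eventually_elim (auto simp: S_def intro: hull_inc closure_subset[THEN subsetD])
  qed (auto simp: S_def intro: convex_closure)
  then have "closure S \<noteq> {}"
    by (metis empty_iff)
  from reg_objective_minimizer_exists[OF assms(1,2) closed_closure this]
  obtain A where A: "A \<in> feasible k (closure S)"
    "\<forall>B\<in>feasible k (closure S). reg_objective \<nu> \<alpha> A \<le> reg_objective \<nu> \<alpha> B"
    by blast
  have opt: "reg_objective \<nu> \<alpha> A = optimal_value \<nu> \<alpha> k S"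
    using assms(1,2) A by (intro optimal_value_eq_min_closure) auto
  have "tuple_mset k (\<lambda>_. \<integral>y. y \<partial>\<nu>) \<in> feasible k (closure S)"
    using mean by (auto simp: feasible_eq)
  from A(2)[rule_format, OF this]
  have "optimal_value \<nu> \<alpha> k S \<le> sqrt (\<integral>x. (norm (x - (\<integral>y. y \<partial>\<nu>)))\<^sup>2 \<partial>\<nu>)"
    by (simp only: opt reg_objective_const_tuple[OF \<open>k \<ge> 1\<close>])
  with A opt show ?thesis
    unfolding S_def by blast
qed

end
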